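(* Let $X$ be a non-negative absolutely continuous random variable with cumulative distribution function $F$. Then the weighted cumulative residual entropy of $X$ can be expressed as $$\mathcal{E}^w(X)=\frac12\sum_{n=1}^{+\infty}\frac{1}{n(n+1)}\,\mu^{(2)}_{n+1:n+1}-\frac12\,\mathbb{E}(X^2),$$ where $\mu^{(2)}_{n+1:n+1}$ is the second moment of the largest order statistic in a sample of size $n+1$ from $F$, provided that $\lim_{x\to+\infty} -\frac{x^2}{2}(1-F(x))\log(1-F(x))=0$.
   Context: $\log$ is the natural logarithm. The weighted cumulative residual entropy of a non-negative absolutely continuous random variable $X$ with cumulative distribution function $F$ is $\mathcal{E}^w(X)=-\int_0^{+\infty}x(1-F(x))\log(1-F(x))\,dx$. For i.i.d. random variables $X_1,\dots,X_m$ with the distribution of $X$, $X_{k:m}$ denotes the $k$-th smallest value (the $k$-th order statistic), and $\mu^{(2)}_{k:m}=\mathbb{E}(X_{k:m}^2)$; in particular $\mu^{(2)}_{m:m}=\mathbb{E}\big(\max(X_1,\dots,X_m)^2\big)$. *)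

theory Defs
  imports "HOL-Probability.Probability"
begin

text \<open>
  All integrals below have non-negative integrands and are taken in \<^typ>\<open>ennreal\<close>, so that the
  value \<open>\<infinity>\<close> is allowed: the limit condition of the theorem does not make the entropy, the series
  or \<open>E(X\<^sup>2)\<close> finite. Their values are combined in \<^typ>\<open>ereal\<close>, whose subtraction is not truncated.
  If \<open>E(X\<^sup>2) = \<infinity>\<close>, the right-hand side \<open>\<infinity> - \<infinity>\<close> is \<open>\<infinity>\<close> by the convention of \<^typ>\<open>ereal\<close>, which is then also
  the value of the entropy.
\<close>

abbreviation cdf_of :: "'a measure \<Rightarrow> ('a \<Rightarrow> real) \<Rightarrow> real \<Rightarrow> real" where
  "cdf_of M X \<equiv> cdf (distr M borel X)"

text \<open>
  As \<open>0 \<le> 1 - F \<le> 1\<close>, the integrand \<open>- x (1 - F x) ln (1 - F x)\<close> is non-negative on \<open>[0, \<infinity>)\<close>, so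
  the minus sign can stand inside the integral and \<^const>\<open>ennreal\<close> truncates nothing.
  Where \<open>F x = 1\<close> the integrand is \<open>0\<close>, i.e. \<open>0 log 0 = 0\<close>.
\<close>
definition weighted_cre :: "'a measure \<Rightarrow> ('a \<Rightarrow> real) \<Rightarrow> ennreal" where
  "weighted_cre M X =
     (\<integral>\<^sup>+x\<in>{0..}. ennreal (- (x * (1 - cdf_of M X x) * ln (1 - cdf_of M X x))) \<partial>lborel)"

text \<open>The \<open>k\<close>-th smallest (counted from \<open>1\<close>) of the values \<open>x 0, \<dots>, x (m - 1)\<close>.\<close>
definition order_stat :: "nat \<Rightarrow> nat \<Rightarrow> (nat \<Rightarrow> real) \<Rightarrow> real" where
  "order_stat k m x = sort (map x [0..<m]) ! (k - 1)"

text \<open>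
  The i.i.d. sample of size \<open>m\<close> from the law of \<open>X\<close> is realised by the coordinates of the
  \<open>m\<close>-fold product of that law.
\<close>
definition order_stat_moment2 :: "'a measure \<Rightarrow> ('a \<Rightarrow> real) \<Rightarrow> nat \<Rightarrow> nat \<Rightarrow> ennreal" where
  "order_stat_moment2 M X k m =
     (\<integral>\<^sup>+x. ennreal ((order_stat k m x)\<^sup>2) \<partial>(\<Pi>\<^sub>M i\<in>{..<m}. distr M borel X))"

definition moment2 :: "'a measure \<Rightarrow> ('a \<Rightarrow> real) \<Rightarrow> ennreal" where
  "moment2 M X = (\<integral>\<^sup>+\<omega>. ennreal ((X \<omega>)\<^sup>2) \<partial>M)"

end

theory Submission
  imports Defs
begin

text \<open>
  Write \<open>S = 1 - F\<close>. A non-negative variable \<open>Y\<close> satisfies \<open>E(Y\<^sup>2) = \<integral> 2 t P(Y > t) dt\<close> over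
  \<open>[0, \<infinity>)\<close> (lemma \<open>second_moment_eq_tail_integral\<close>). The maximum of \<open>m\<close> independent copies of
  \<open>X\<close> has distribution function \<open>F ^ m\<close>, so that its second moment is \<open>\<integral> 2 t (1 - F t ^ m) dt\<close>.
  Tonelli's theorem for the non-negative summands moves the sum over \<open>n\<close> under the integral, where
  the logarithmic series (lemma \<open>log_series_one_minus_power\<close>) evaluates it pointwise:
  \<open>(\<Sum>n\<ge>1. (1 - F ^ (n + 1)) / (n (n + 1))) = S - S ln S\<close>. Integrating against \<open>2 t\<close> yields
  \<open>E(X\<^sup>2)\<close> plus twice the weighted entropy, as an identity between elements of \<open>[0, \<infinity>]\<close>.

  Solving this identity for the entropy requires cancelling \<open>E(X\<^sup>2)\<close>, which is possible when it
  is finite. If it is infinite, then so is the entropy: eventually \<open>S \<le> exp (- 1)\<close>, where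
  \<open>S \<le> - S ln S\<close>, and so the entropy dominates a tail of the divergent integral of \<open>t S t\<close>
  (lemma \<open>moment2_le_weighted_cre\<close>). The convention \<open>\<infinity> - \<infinity> = \<infinity>\<close> then makes both sides equal.
\<close>

section \<open>A logarithmic series\<close>

text \<open>
  Partial fractions split the summand into a telescoping part and two shifted copies of the series
  of \<open>- ln (1 - u)\<close>. At \<open>u = 1\<close>, where that series diverges, all summands vanish, and so does the
  right-hand side since \<open>ln 0 = 0\<close>.
\<close>
lemma log_series_one_minus_power:
  fixes u :: real
  assumes "0 \<le> u" "u \<le> 1"
  shows "(\<lambda>i. (1 - u ^ (i + 2)) / ((real i + 1) * (real i + 2))) sums
           ((1 - u) - (1 - u) * ln (1 - u))"
proof (cases "u = 1")
  case True
  then show ?thesis by simp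
next
  case False
  with assms have u: "0 \<le> u" "u < 1" by auto
  define L where "L = - ln (1 - u)"
  have ser: "(\<lambda>n. u ^ n / real n) sums L"
  proof -
    have "(\<lambda>n. - ((- (- u)) ^ n) / real n) sums ln (1 + - u)"
      by (rule ln_series') (use u in auto)
    from sums_minus[OF this] show ?thesis by (simp add: L_def)
  qed
  have ser1: "(\<lambda>i. u ^ Suc i / real (Suc i)) sums L"
    using ser by (subst sums_Suc_iff) simp
  have ser2: "(\<lambda>i. u ^ Suc (Suc i) / real (Suc (Suc i))) sums (L - u)"
    using ser1 by (subst sums_Suc_iff) simp
  have tele: "(\<lambda>i. 1 / (real i + 1) - 1 / (real i + 2)) sums 1"
  proof -
    have "(\<lambda>i. 1 / (real i + 1)) \<longlonglongrightarrow> 0"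
      using LIMSEQ_inverse_real_of_nat by (simp add: field_simps)
    from telescope_sums'[OF this] show ?thesis by (simp add: add_ac)
  qed
  have "(\<lambda>i. (1 / (real i + 1) - 1 / (real i + 2))
           - (u * (u ^ Suc i / real (Suc i)) - u ^ Suc (Suc i) / real (Suc (Suc i))))
        sums (1 - (u * L - (L - u)))"
    by (intro sums_diff tele sums_mult ser1 ser2)
  moreover have "(1 / (real i + 1) - 1 / (real i + 2))
           - (u * (u ^ Suc i / real (Suc i)) - u ^ Suc (Suc i) / real (Suc (Suc i)))
      = (1 - u ^ (i + 2)) / ((real i + 1) * (real i + 2))" for i
    by (simp add: divide_simps) (simp add: algebra_simps)
  ultimately show ?thesis
    by (simp add: L_def algebra_simps)
qed

section \<open>Second moments as tail integrals\<close>

lemma nn_integral_twice_identity: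
  assumes "0 \<le> (y::real)"
  shows "(\<integral>\<^sup>+t. ennreal (2 * t) * indicator {0..<y} t \<partial>lborel) = ennreal (y\<^sup>2)"
proof -
  have "(\<integral>\<^sup>+t. ennreal (2 * t) * indicator {0..<y} t \<partial>lborel)
      = (\<integral>\<^sup>+t. ennreal (2 * t) * indicator {0..y} t \<partial>lborel)"
    by (rule nn_integral_cong_AE) (use AE_lborel_singleton[of y] in eventually_elim,
        auto split: split_indicator)
  also have "\<dots> = ennreal (y\<^sup>2 - 0\<^sup>2)"
    by (rule nn_integral_FTC_Icc)
      (use assms in \<open>auto intro!: derivative_eq_intros simp: has_real_derivative_iff_has_vector_derivative[symmetric]\<close>)
  finally show ?thesis by simp
qed

text \<open>
  Layer-cake formula: \<open>y\<^sup>2\<close> is the integral of \<open>2 t\<close> over \<open>0 \<le> t < y\<close>; the two integrations are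
  then exchanged.
\<close>
lemma second_moment_eq_tail_integral:
  assumes "prob_space N" and Y [measurable]: "Y \<in> borel_measurable N"
    and nonneg: "AE \<omega> in N. 0 \<le> Y \<omega>"
  shows "(\<integral>\<^sup>+\<omega>. ennreal ((Y \<omega>)\<^sup>2) \<partial>N) =
         (\<integral>\<^sup>+t\<in>{0..}. ennreal (2 * t * (1 - cdf_of N Y t)) \<partial>lborel)"
proof -
  interpret N: prob_space N by fact
  interpret pair_sigma_finite N lborel ..
  have tail: "emeasure N {\<omega> \<in> space N. t < Y \<omega>} = ennreal (1 - cdf_of N Y t)" for t
  proof -
    have "cdf_of N Y t = N.prob {\<omega> \<in> space N. Y \<omega> \<le> t}"
      by (auto simp: cdf_def measure_distr vimage_def Int_def conj_commute)
    moreover have "N.prob {\<omega> \<in> space N. \<not> Y \<omega> \<le> t} = 1 - N.prob {\<omega> \<in> space N. Y \<omega> \<le> t}"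
      by (rule N.prob_neg) measurable
    ultimately show ?thesis by (simp add: N.emeasure_eq_measure not_le)
  qed
  have "(\<integral>\<^sup>+\<omega>. ennreal ((Y \<omega>)\<^sup>2) \<partial>N)
      = (\<integral>\<^sup>+\<omega>. (\<integral>\<^sup>+t. ennreal (2 * t) * indicator {0..<Y \<omega>} t \<partial>lborel) \<partial>N)"
    by (rule nn_integral_cong_AE)
      (use nonneg in eventually_elim, simp add: nn_integral_twice_identity)
  also have "\<dots> = (\<integral>\<^sup>+\<omega>. (\<integral>\<^sup>+t. (if 0 \<le> t \<and> t < Y \<omega> then ennreal (2 * t) else 0) \<partial>lborel) \<partial>N)"
    by (intro nn_integral_cong) (auto split: split_indicator)
  also have "\<dots> = (\<integral>\<^sup>+t. (\<integral>\<^sup>+\<omega>. (if 0 \<le> t \<and> t < Y \<omega> then ennreal (2 * t) else 0) \<partial>N) \<partial>lborel)"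
    by (rule Fubini'[symmetric]) measurable
  also have "\<dots> = (\<integral>\<^sup>+t. ennreal (2 * t * (1 - cdf_of N Y t)) * indicator {0..} t \<partial>lborel)"
  proof (rule nn_integral_cong)
    fix t :: real
    have "(\<integral>\<^sup>+\<omega>. (if 0 \<le> t \<and> t < Y \<omega> then ennreal (2 * t) else 0) \<partial>N)
        = (\<integral>\<^sup>+\<omega>. (ennreal (2 * t) * indicator {0..} t) *
             indicator {\<omega> \<in> space N. t < Y \<omega>} \<omega> \<partial>N)"
      by (intro nn_integral_cong) (auto split: split_indicator)
    also have "\<dots> = ennreal (2 * t) * indicator {0..} t * ennreal (1 - cdf_of N Y t)"
      by (subst nn_integral_cmult_indicator) (simp_all add: tail)
    also have "\<dots> = ennreal (2 * t * (1 - cdf_of N Y t)) * indicator {0..} t"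
      by (auto split: split_indicator simp: ennreal_mult'')
        (simp add: ennreal_mult')
    finally show "(\<integral>\<^sup>+\<omega>. (if 0 \<le> t \<and> t < Y \<omega> then ennreal (2 * t) else 0) \<partial>N)
        = ennreal (2 * t * (1 - cdf_of N Y t)) * indicator {0..} t" .
  qed
  finally show ?thesis .
qed

section \<open>The largest order statistic\<close>

lemma order_stat_max_le_iff:
  assumes "0 < m"
  shows "order_stat m m x \<le> t \<longleftrightarrow> (\<forall>i<m. x i \<le> t)"
proof -
  let ?l = "sort (map x [0..<m])"
  have len: "length ?l = m" by simp
  have "?l ! (m - 1) \<in> set ?l" using assms by (intro nth_mem) simp
  moreover have "y \<le> ?l ! (m - 1)" if "y \<in> set ?l" for y
  proof -
    from that obtain i where "i < m" "y = ?l ! i" by (metis in_set_conv_nth len)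
    then show ?thesis using assms by (auto intro!: sorted_nth_mono)
  qed
  ultimately have "?l ! (m - 1) \<le> t \<longleftrightarrow> (\<forall>y\<in>set ?l. y \<le> t)"
    by (meson order_trans)
  then show ?thesis by (auto simp: order_stat_def)
qed

lemma order_stat_max_measurable:
  assumes "0 < m" "sets P = sets borel"
  shows "order_stat m m \<in> borel_measurable (\<Pi>\<^sub>M i\<in>{..<m}. P)"
proof -
  have [measurable]: "(\<lambda>x. x i) \<in> borel_measurable (\<Pi>\<^sub>M i\<in>{..<m}. P)" if "i \<in> {..<m}" for i
    using measurable_component_singleton[OF that, of "\<lambda>_. P"]
    by (simp add: measurable_cong_sets[OF refl assms(2)])
  show ?thesis
    unfolding borel_measurable_iff_le
  proof
    fix t
    have "{x \<in> space (\<Pi>\<^sub>M i\<in>{..<m}. P). \<forall>i\<in>{..<m}. x i \<le> t} \<in> sets (\<Pi>\<^sub>M i\<in>{..<m}. P)"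
      by measurable
    then show "{x \<in> space (\<Pi>\<^sub>M i\<in>{..<m}. P). order_stat m m x \<le> t} \<in> sets (\<Pi>\<^sub>M i\<in>{..<m}. P)"
      by (simp add: order_stat_max_le_iff[OF assms(1)] Ball_def)
  qed
qed

text \<open>
  The maximum is at most \<open>t\<close> exactly on the cube with sides \<open>(-\<infinity>, t]\<close>, whose product measure is a
  power.
\<close>
lemma cdf_order_stat_max:
  assumes "0 < m" "prob_space P" "sets P = sets borel"
  shows "cdf_of (\<Pi>\<^sub>M i\<in>{..<m}. P) (order_stat m m) t = cdf P t ^ m"
proof -
  let ?Q = "\<Pi>\<^sub>M i\<in>{..<m}. P"
  interpret factor: prob_space P by fact
  interpret Q: finite_product_prob_space "\<lambda>_. P" "{..<m}" by unfold_locales auto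
  have [measurable]: "order_stat m m \<in> borel_measurable ?Q"
    by (rule order_stat_max_measurable[OF assms(1,3)])
  have sp: "space P = UNIV" using sets_eq_imp_space_eq[OF assms(3)] by simp
  have "cdf_of ?Q (order_stat m m) t = measure ?Q (order_stat m m -` {..t} \<inter> space ?Q)"
    by (simp add: cdf_def measure_distr)
  also have "order_stat m m -` {..t} \<inter> space ?Q = (\<Pi>\<^sub>E i\<in>{..<m}. {..t})"
    by (rule set_eqI)
      (simp add: order_stat_max_le_iff[OF assms(1)] space_PiM sp PiE_iff Ball_def)
  also have "measure ?Q \<dots> = (\<Prod>i\<in>{..<m}. measure P {..t})"
    by (rule Q.prob_times) (simp add: assms(3))
  finally show ?thesis by (simp add: cdf_def)
qed

lemma order_stat_moment2_max:
  assumes "prob_space M" and X [measurable]: "X \<in> borel_measurable M"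
    and nonneg: "AE \<omega> in M. 0 \<le> X \<omega>" and m: "0 < m"
  shows "order_stat_moment2 M X m m =
         (\<integral>\<^sup>+t\<in>{0..}. ennreal (2 * t * (1 - cdf_of M X t ^ m)) \<partial>lborel)"
proof -
  let ?P = "distr M borel X"
  let ?Q = "\<Pi>\<^sub>M i\<in>{..<m}. ?P"
  interpret M: prob_space M by fact
  have P: "prob_space ?P" by (rule M.prob_space_distr) simp
  have "AE x in ?Q. 0 \<le> x 0"
    by (rule AE_PiM_component) (use P m nonneg in \<open>auto simp: AE_distr_iff\<close>)
  then have "AE x in ?Q. 0 \<le> order_stat m m x"
    by eventually_elim (use m in \<open>meson order_stat_max_le_iff order_refl order_trans\<close>)
  then have "order_stat_moment2 M X m m =
      (\<integral>\<^sup>+t\<in>{0..}. ennreal (2 * t * (1 - cdf_of ?Q (order_stat m m) t)) \<partial>lborel)"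
    unfolding order_stat_moment2_def
    by (intro second_moment_eq_tail_integral prob_space_PiM P order_stat_max_measurable m) auto
  then show ?thesis by (simp add: cdf_order_stat_max[OF m P])
qed

section \<open>The entropy identity in extended non-negative numbers\<close>

lemma cdf_of_bounds:
  assumes "prob_space M" "X \<in> borel_measurable M"
  shows "0 \<le> cdf_of M X t" "cdf_of M X t \<le> 1"
proof -
  interpret prob_space "distr M borel X"
    by (rule prob_space.prob_space_distr) (use assms in auto)
  show "0 \<le> cdf_of M X t" "cdf_of M X t \<le> 1" by (auto simp: cdf_def)
qed

lemma cdf_of_measurable:
  assumes "prob_space M" "X \<in> borel_measurable M"
  shows "cdf_of M X \<in> borel_measurable borel"
proof (rule borel_measurable_mono)
  interpret real_distribution "distr M borel X"
    by (rule prob_space.real_distribution_distr) (use assms in auto)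
  show "mono (cdf_of M X)" by (auto intro: monoI cdf_nondecreasing)
qed

lemma minus_mult_ln_nonneg:
  fixes s :: real
  assumes "0 \<le> s" "s \<le> 1"
  shows "0 \<le> - (s * ln s)"
  using assms by (cases "s = 0") (auto simp: mult_le_0_iff)

text \<open>
  The first summand on the right comes from the term \<open>S\<close> of the pointwise sum \<open>S - S ln S\<close>, the
  second from \<open>- S ln S\<close>.
\<close>
lemma suminf_order_stat_moment2:
  assumes "prob_space M" and X: "X \<in> borel_measurable M"
    and nonneg: "AE \<omega> in M. 0 \<le> X \<omega>"
  shows "(\<Sum>i. let n = Suc i in
           ennreal (1 / (real n * (real n + 1))) * order_stat_moment2 M X (n + 1) (n + 1))
         = moment2 M X + 2 * weighted_cre M X"
proof -
  define F where "F = cdf_of M X"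
  have F01: "0 \<le> F t" "F t \<le> 1" for t
    unfolding F_def using cdf_of_bounds[OF assms(1,2)] by auto
  have [measurable]: "F \<in> borel_measurable borel"
    unfolding F_def by (rule cdf_of_measurable[OF assms(1,2)])
  define a where "a i t = (1 - F t ^ (i + 2)) / ((real i + 1) * (real i + 2))" for i t
  have a_nonneg: "0 \<le> a i t" for i t
    using power_le_one[OF F01[of t], of "i + 2"] by (simp add: a_def)
  have summand: "(let n = Suc i in
      ennreal (1 / (real n * (real n + 1))) * order_stat_moment2 M X (n + 1) (n + 1))
      = (\<integral>\<^sup>+t. ennreal (2 * t * a i t) * indicator {0..} t \<partial>lborel)" for i
  proof -
    define c where "c = 1 / ((real i + 1) * (real i + 2))"
    have c: "0 \<le> c" by (simp add: c_def)
    have "(let n = Suc i in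
      ennreal (1 / (real n * (real n + 1))) * order_stat_moment2 M X (n + 1) (n + 1))
      = ennreal c * (\<integral>\<^sup>+t. ennreal (2 * t * (1 - F t ^ (i + 2))) * indicator {0..} t \<partial>lborel)"
      by (simp add: Let_def order_stat_moment2_max[OF assms] F_def c_def add_ac)
    also have "\<dots> = (\<integral>\<^sup>+t. ennreal c *
        (ennreal (2 * t * (1 - F t ^ (i + 2))) * indicator {0..} t) \<partial>lborel)"
      by (rule nn_integral_cmult[symmetric]) measurable
    also have "\<dots> = (\<integral>\<^sup>+t. ennreal (2 * t * a i t) * indicator {0..} t \<partial>lborel)"
    proof (rule nn_integral_cong)
      fix t
      have "ennreal c * ennreal (2 * t * (1 - F t ^ (i + 2)))
          = ennreal (c * (2 * t * (1 - F t ^ (i + 2))))"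
        by (rule ennreal_mult'[OF c, symmetric])
      also have "c * (2 * t * (1 - F t ^ (i + 2))) = 2 * t * a i t"
        by (simp add: a_def c_def)
      finally show "ennreal c * (ennreal (2 * t * (1 - F t ^ (i + 2))) * indicator {0..} t)
          = ennreal (2 * t * a i t) * indicator {0..} t"
        by (simp only: mult.assoc[symmetric])
    qed
    finally show ?thesis .
  qed
  have pointwise: "(\<Sum>i. ennreal (2 * t * a i t) * indicator {0..} t)
      = ennreal (2 * t * (1 - F t)) * indicator {0..} t
        + 2 * (ennreal (- (t * (1 - F t) * ln (1 - F t))) * indicator {0..} t)" for t
  proof (cases "0 \<le> t")
    case True
    define s where "s = 1 - F t"
    have s: "0 \<le> s" "s \<le> 1" using F01[of t] by (auto simp: s_def)
    have "(\<lambda>i. 2 * t * a i t) sums (2 * t * (s - s * ln s))"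
      unfolding a_def s_def by (intro sums_mult log_series_one_minus_power F01)
    then have "(\<Sum>i. ennreal (2 * t * a i t)) = ennreal (2 * t * (s - s * ln s))"
      using True a_nonneg
      by (subst suminf_ennreal2) (auto simp: sums_iff intro!: mult_nonneg_nonneg)
    also have "2 * t * (s - s * ln s) = 2 * t * s + 2 * - (t * s * ln s)"
      by (simp add: algebra_simps)
    also have "ennreal \<dots> = ennreal (2 * t * s) + ennreal (2 * - (t * s * ln s))"
    proof (rule ennreal_plus)
      show "0 \<le> 2 * t * s" using True s by simp
      show "0 \<le> 2 * - (t * s * ln s)"
        using mult_nonneg_nonneg[OF True minus_mult_ln_nonneg[OF s]] by (simp add: mult_ac)
    qed
    also have "ennreal (2 * - (t * s * ln s)) = 2 * ennreal (- (t * s * ln s))"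
      by (subst ennreal_mult') auto
    finally show ?thesis using True by (simp add: s_def)
  qed simp
  have "(\<Sum>i. let n = Suc i in
           ennreal (1 / (real n * (real n + 1))) * order_stat_moment2 M X (n + 1) (n + 1))
      = (\<Sum>i. (\<integral>\<^sup>+t. ennreal (2 * t * a i t) * indicator {0..} t \<partial>lborel))"
    by (simp only: summand)
  also have "\<dots> = (\<integral>\<^sup>+t. (\<Sum>i. ennreal (2 * t * a i t) * indicator {0..} t) \<partial>lborel)"
    unfolding a_def by (rule nn_integral_suminf[symmetric]) measurable
  also have "\<dots> = (\<integral>\<^sup>+t. ennreal (2 * t * (1 - F t)) * indicator {0..} t
        + 2 * (ennreal (- (t * (1 - F t) * ln (1 - F t))) * indicator {0..} t) \<partial>lborel)"
    by (simp only: pointwise)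
  also have "\<dots> = (\<integral>\<^sup>+t. ennreal (2 * t * (1 - F t)) * indicator {0..} t \<partial>lborel)
        + 2 * (\<integral>\<^sup>+t. ennreal (- (t * (1 - F t) * ln (1 - F t))) * indicator {0..} t \<partial>lborel)"
    by (subst nn_integral_add) (simp_all add: nn_integral_cmult)
  finally show ?thesis
    by (simp add: moment2_def weighted_cre_def second_moment_eq_tail_integral[OF assms] F_def)
qed

text \<open>
  Infinite second moment forces infinite entropy. The cut-off \<open>r\<close> is chosen so that
  \<open>1 - F \<le> exp (- 1)\<close>, that is \<open>- ln (1 - F) \<ge> 1\<close>, beyond it; up to \<open>r\<close> the tail integrand is
  at most \<open>2 t\<close>, which integrates to \<open>r\<^sup>2\<close>.
\<close>
lemma moment2_le_weighted_cre:
  assumes "prob_space M" and X: "X \<in> borel_measurable M"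
    and nonneg: "AE \<omega> in M. 0 \<le> X \<omega>"
  obtains r where "moment2 M X \<le> ennreal (r\<^sup>2) + 2 * weighted_cre M X"
proof -
  define F where "F = cdf_of M X"
  have F01: "0 \<le> F t" "F t \<le> 1" for t
    unfolding F_def using cdf_of_bounds[OF assms(1,2)] by auto
  have [measurable]: "F \<in> borel_measurable borel"
    unfolding F_def by (rule cdf_of_measurable[OF assms(1,2)])
  interpret D: real_distribution "distr M borel X"
    by (rule prob_space.real_distribution_distr) (use assms in auto)
  have "(F \<longlongrightarrow> 1) at_top" unfolding F_def by (rule D.cdf_lim_at_top_prob)
  then have "eventually (\<lambda>t. 1 - exp (- 1) < F t) at_top"
    by (rule order_tendstoD) simp
  then obtain r0 where r0: "\<And>t. r0 \<le> t \<Longrightarrow> 1 - exp (- 1) < F t"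
    by (auto simp: eventually_at_top_linorder)
  define r where "r = max 0 r0"
  have bound: "ennreal (2 * t * (1 - F t)) * indicator {0..} t
      \<le> ennreal (2 * t) * indicator {0..<r} t
        + 2 * (ennreal (- (t * (1 - F t) * ln (1 - F t))) * indicator {0..} t)" for t
  proof (cases "r \<le> t")
    case True
    define s where "s = 1 - F t"
    have t: "0 \<le> t" and s: "0 \<le> s" "s < exp (- 1)"
      using True r0[of t] F01[of t] by (auto simp: r_def s_def)
    have "s \<le> - (s * ln s)"
    proof (cases "s = 0")
      case False
      with s have "ln s < ln (exp (- 1))" by (subst ln_less_cancel_iff) auto
      then have "s * 1 \<le> s * (- ln s)" using s by (intro mult_left_mono) auto
      then show ?thesis by simp
    qed simp
    then have "t * s \<le> t * - (s * ln s)" using t by (intro mult_left_mono) auto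
    then have "ennreal (2 * t * s) \<le> ennreal (2 * - (t * s * ln s))"
      by (intro ennreal_leI) (simp add: algebra_simps)
    also have "\<dots> = 2 * ennreal (- (t * s * ln s))"
      by (subst ennreal_mult') auto
    finally show ?thesis using True t by (simp add: s_def)
  next
    case False
    have "ennreal (2 * t * (1 - F t)) \<le> ennreal (2 * t)" if "0 \<le> t"
      using that F01[of t] by (intro ennreal_leI) (simp add: mult_left_le)
    with False show ?thesis by (auto split: split_indicator intro: add_increasing2)
  qed
  have "moment2 M X = (\<integral>\<^sup>+t. ennreal (2 * t * (1 - F t)) * indicator {0..} t \<partial>lborel)"
    by (simp add: moment2_def second_moment_eq_tail_integral[OF assms] F_def)
  also have "\<dots> \<le> (\<integral>\<^sup>+t. ennreal (2 * t) * indicator {0..<r} t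
        + 2 * (ennreal (- (t * (1 - F t) * ln (1 - F t))) * indicator {0..} t) \<partial>lborel)"
    by (intro nn_integral_mono bound)
  also have "\<dots> = (\<integral>\<^sup>+t. ennreal (2 * t) * indicator {0..<r} t \<partial>lborel)
        + 2 * (\<integral>\<^sup>+t. ennreal (- (t * (1 - F t) * ln (1 - F t))) * indicator {0..} t \<partial>lborel)"
    by (subst nn_integral_add) (simp_all add: nn_integral_cmult)
  also have "\<dots> = ennreal (r\<^sup>2) + 2 * weighted_cre M X"
    by (simp add: nn_integral_twice_identity r_def weighted_cre_def F_def)
  finally show ?thesis by (rule that)
qed

section \<open>Solving for the entropy\<close>

text \<open>
  For \<open>m = \<infinity>\<close> the right-hand side is \<open>\<infinity> - \<infinity> = \<infinity>\<close>, which is why \<open>w\<close> has to be infinite as well.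
\<close>
lemma half_add_minus_half_ereal:
  fixes m w :: ennreal
  assumes "m = \<infinity> \<Longrightarrow> w = \<infinity>"
  shows "enn2ereal w = ereal (1 / 2) * enn2ereal (m + 2 * w) - ereal (1 / 2) * enn2ereal m"
proof (cases w)
  case top
  then show ?thesis
    by (cases m) (auto simp: ennreal_mult_top top_ereal_def)
next
  case (real b)
  with assms obtain a where "0 \<le> a" "m = ennreal a" by (cases m) auto
  moreover have "ennreal a + 2 * ennreal b = ennreal (a + 2 * b)"
    using real \<open>0 \<le> a\<close> by (simp add: ennreal_plus ennreal_mult)
  ultimately show ?thesis
    using real by (simp add: enn2ereal_ennreal field_simps del: ennreal_plus)
qed

theorem mainTheorem3:
  fixes M :: "'a measure" and X :: "'a \<Rightarrow> real" and f :: "real \<Rightarrow> ennreal"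
  assumes "prob_space M"
    and "distributed M lborel X f"
    and "AE \<omega> in M. 0 \<le> X \<omega>"
    and "((\<lambda>x. - (x\<^sup>2 / 2) * (1 - cdf_of M X x) * ln (1 - cdf_of M X x)) \<longlongrightarrow> 0) at_top"
  shows "enn2ereal (weighted_cre M X) =
    ereal (1 / 2) * enn2ereal (\<Sum>i. let n = Suc i in
        ennreal (1 / (real n * (real n + 1))) * order_stat_moment2 M X (n + 1) (n + 1))
    - ereal (1 / 2) * enn2ereal (moment2 M X)"
proof -
  have X: "X \<in> borel_measurable M"
    using distributed_measurable[OF assms(2)] by simp
  obtain r where "moment2 M X \<le> ennreal (r\<^sup>2) + 2 * weighted_cre M X"
    by (rule moment2_le_weighted_cre[OF assms(1) X assms(3)])
  then have "weighted_cre M X = \<infinity>" if "moment2 M X = \<infinity>"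
    using that by (auto simp: top_unique ennreal_mult_eq_top_iff)
  then show ?thesis
    unfolding suminf_order_stat_moment2[OF assms(1) X assms(3)]
    by (rule half_add_minus_half_ereal)
qed

end
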